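(* Let $f:\mathbb{R}^{n\times m}\to\mathbb{R}$ be a smooth convex function and let $\lambda>0$. If $X=UBV^T$ is a stationary point of the fixed-rank problem $$\min_{U,B,V}\; f(UBV^T)+\lambda\,\mathrm{Trace}(B)\quad\text{subject to } U\in \mathrm{St}(p,n),\; B\in S_{++}(p),\; V\in \mathrm{St}(p,m),$$ then the rank-one update $$X_+=X-\beta uv^T$$ ensures a decrease in the objective function $f(X)+\lambda\|X\|_*$ provided that $\beta>0$ is sufficiently small and the descent directions $u\in\mathbb{R}^n$ and $v\in\mathbb{R}^m$ are the dominant left and right singular vectors, with singular value $\sigma_1$, of the dual variable $S=\mathrm{Grad}_X f(UBV^T)$. The maximum decrease in the objective function is obtained for $$\beta=\frac{\sigma_1-\lambda}{L_f},$$ where $L_f$ is the Lipschitz constant such that $\|\nabla f(X)-\nabla f(Y)\|_F\le L_f\|X-Y\|_F$ for all $X,Y\in\mathbb{R}^{n\times m}$.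
   Context: $\mathrm{St}(p,n)=\{U\in\mathbb{R}^{n\times p}: U^TU=I_p\}$ is the Stiefel manifold of $n\times p$ matrices with orthonormal columns, and $\mathrm{St}(p,m)$ is defined likewise. $S_{++}(p)$ is the cone of $p\times p$ symmetric positive definite real matrices. $\|X\|_*$ is the trace norm (sum of the singular values of $X$) and $\|\cdot\|_F$ is the Frobenius norm. $\nabla f(X)=\mathrm{Grad}_X f(X)\in\mathbb{R}^{n\times m}$ is the Euclidean gradient of $f$ at $X$; $\mathrm{Grad}_X f(UBV^T)$ is this gradient evaluated at $UBV^T$. The dominant singular vectors $u,v$ are the unit left and right singular vectors of $S$ associated with its largest singular value $\sigma_1$. With $\mathrm{Sym}(\Delta)=\tfrac12(\Delta+\Delta^T)$, $X=UBV^T$ (with $(U,B,V)$ feasible) is a stationary point of the fixed-rank problem if the first-order optimality conditions hold: $SVB-U\,\mathrm{Sym}(U^TSVB)=0$, $\mathrm{Sym}(U^TSV+\lambda I)=0$, and $S^TUB-V\,\mathrm{Sym}(V^TS^TUB)=0$. The fixed-rank problem is the rank-$p$ factorized version of the convex problem $\min_{X\in\mathbb{R}^{n\times m}} f(X)+\lambda\|X\|_*$, using $\|UBV^T\|_*=\mathrm{Trace}(B)$.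
   Formalization: The decrease is claimed only when X is not already a global minimizer of f+λ‖·‖_*; "maximum decrease" means the maximum of the decrease guaranteed by L_f and S (worst case over convex functions with L_f-Lipschitz gradient equal to S at X), since the exact maximum for one f can be at another β. *)

theory Defs
  imports "HOL-Analysis.Analysis"
begin

text \<open>
  An \<open>n \<times> m\<close> matrix is an element of \<^typ>\<open>real^'m^'n\<close>. On this type the
  library's \<^const>\<open>norm\<close> and \<^const>\<open>inner\<close> are the Frobenius norm and the trace inner
  product, so that \<open>GDERIV f X :> D\<close> says that the Euclidean gradient of \<open>f\<close> at \<open>X\<close> is the
  matrix \<open>D\<close>.
\<close>

definition stiefel :: "(real^'p^'n) set" where
  "stiefel = {U. transpose U ** U = mat 1}"

definition sym_posdef :: "(real^'p^'p) set" where
  "sym_posdef = {B. transpose B = B \<and> (\<forall>x. x \<noteq> 0 \<longrightarrow> x \<bullet> (B *v x) > 0)}"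

definition sym_part :: "real^'p^'p \<Rightarrow> real^'p^'p" where
  "sym_part D = (1/2) *\<^sub>R (D + transpose D)"

definition outer :: "real^'n \<Rightarrow> real^'m \<Rightarrow> real^'m^'n" where
  "outer u v = (\<chi> i j. u $ i * v $ j)"

definition singular_vectors :: "real^'m^'n \<Rightarrow> real \<Rightarrow> real^'n \<Rightarrow> real^'m \<Rightarrow> bool" where
  "singular_vectors A s u v \<longleftrightarrow> s \<ge> 0 \<and> norm u = 1 \<and> norm v = 1 \<and>
     A *v v = s *\<^sub>R u \<and> transpose A *v u = s *\<^sub>R v"

definition singular_values :: "real^'m^'n \<Rightarrow> real set" where
  "singular_values A = {s. \<exists>u v. singular_vectors A s u v}"

definition dominant_singular_vectors :: "real^'m^'n \<Rightarrow> real \<Rightarrow> real^'n \<Rightarrow> real^'m \<Rightarrow> bool" where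
  "dominant_singular_vectors A s u v \<longleftrightarrow>
     singular_vectors A s u v \<and> (\<forall>t\<in>singular_values A. t \<le> s)"

text \<open>
  The trace norm is the sum of the singular values counted with multiplicity. The multiplicity of
  a singular value \<open>s > 0\<close> is the dimension of its space of right singular vectors, i.e. of the
  eigenspace of \<open>A\<^sup>T A\<close> for \<open>s\<^sup>2\<close>; a singular value \<open>0\<close> contributes nothing.
\<close>

definition trace_norm :: "real^'m^'n \<Rightarrow> real" where
  "trace_norm A = (\<Sum>s\<in>singular_values A.
     s * real (dim {v. (transpose A ** A) *v v = s\<^sup>2 *\<^sub>R v}))"

definition objective :: "(real^'m^'n \<Rightarrow> real) \<Rightarrow> real \<Rightarrow> real^'m^'n \<Rightarrow> real" where
  "objective f lam X = f X + lam * trace_norm X"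

text \<open>
  First-order optimality conditions of \<open>f (U B V\<^sup>T) + lam * Trace B\<close> at a feasible \<open>(U, B, V)\<close>;
  \<open>G\<close> is the gradient map of \<open>f\<close>.
\<close>

definition stationary_point ::
  "(real^'m^'n \<Rightarrow> real^'m^'n) \<Rightarrow> real \<Rightarrow> real^'p^'n \<Rightarrow> real^'p^'p \<Rightarrow> real^'p^'m \<Rightarrow> bool" where
  "stationary_point G lam U B V \<longleftrightarrow>
     U \<in> stiefel \<and> B \<in> sym_posdef \<and> V \<in> stiefel \<and>
     (let S = G (U ** B ** transpose V) in
        S ** V ** B - U ** sym_part (transpose U ** S ** V ** B) = 0 \<and>
        sym_part (transpose U ** S ** V + lam *\<^sub>R mat 1) = 0 \<and>
        transpose S ** U ** B - V ** sym_part (transpose V ** transpose S ** U ** B) = 0)"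

definition lipschitz_gradient :: "real \<Rightarrow> (real^'m^'n \<Rightarrow> real^'m^'n) \<Rightarrow> bool" where
  "lipschitz_gradient L G \<longleftrightarrow> (\<forall>Y Z. norm (G Y - G Z) \<le> L * norm (Y - Z))"

text \<open>
  The convex functions with \<open>L\<close>-Lipschitz gradient whose gradient at \<open>X\<close> is \<open>S\<close>. Stationarity of
  a factorization of \<open>X\<close> depends on the function only through \<open>S\<close>, so either all or none of these
  functions have a given factorization of \<open>X\<close> as a stationary point.
\<close>

definition compatible_functions ::
  "real \<Rightarrow> real^'m^'n \<Rightarrow> real^'m^'n \<Rightarrow> (real^'m^'n \<Rightarrow> real) set" where
  "compatible_functions L X S = {h. convex_on UNIV h \<and>
     (\<exists>G. (\<forall>Y. GDERIV h Y :> G Y) \<and> lipschitz_gradient L G \<and> G X = S)}"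

text \<open>
  The decrease of the objective along \<open>X - b u v\<^sup>T\<close> that can be guaranteed from the Lipschitz
  constant \<open>L\<close> and the dual variable \<open>S\<close>. The step \<open>(s - lam) / L\<close> maximizes this quantity; it need
  not maximize the decrease for one individual function, whose curvature in the direction \<open>u v\<^sup>T\<close>
  may be smaller than \<open>L\<close>.
\<close>

definition guaranteed_decrease ::
  "real \<Rightarrow> real \<Rightarrow> real^'m^'n \<Rightarrow> real^'m^'n \<Rightarrow> real^'n \<Rightarrow> real^'m \<Rightarrow> real \<Rightarrow> real" where
  "guaranteed_decrease lam L X S u v b =
     (INF h\<in>compatible_functions L X S.
        objective h lam X - objective h lam (X - b *\<^sub>R outer u v))"

end

theory Submission
  imports Defs
begin

text \<open>
  Everything rests on two facts about a stationary point \<open>X = U B V\<^sup>T\<close> with dual variable \<open>S\<close>.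

  The first is that \<open>S V = - lam U\<close> and \<open>S\<^sup>T U = - lam V\<close> (\<open>stationary_point_dual\<close>). The first-order
  conditions fix the symmetric part of \<open>U\<^sup>T S V\<close> only, but its skew part anticommutes with the
  positive definite \<open>B\<close> and therefore vanishes. Hence \<open>lam\<close> is a singular value of \<open>S\<close>, and
  \<open>lam \<le> \<sigma>\<^sub>1\<close>.

  The second is that the step \<open>X - b u v\<^sup>T\<close> increases the trace norm by exactly \<open>b \<ge> 0\<close>
  (\<open>trace_norm_rank_one_step\<close>). The trace norm of \<open>A\<close> is the maximum of \<open>\<langle>W, A\<rangle>\<close> over contractions
  \<open>W\<close> (\<open>inner_contraction_le_trace_norm\<close>, \<open>trace_norm_attained\<close>); this comes from evaluating traces in
  an orthonormal eigenbasis of \<open>A\<^sup>T A\<close>. By this duality the increase is at most \<open>b\<close>, and equality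
  follows by exhibiting a suitable \<open>W\<close>.

  If \<open>\<sigma>\<^sub>1 = lam\<close>, then \<open>- S / lam\<close> is a contraction at which the trace norm of \<open>X\<close> is attained, so by
  convexity \<open>X\<close> is a global minimizer. Otherwise \<open>\<sigma>\<^sub>1 > lam\<close>, and the objective has the negative
  derivative \<open>lam - \<sigma>\<^sub>1\<close> along the step. For the quantitative part, the descent lemma gives at
  least the decrease \<open>b (\<sigma>\<^sub>1 - lam - L b / 2)\<close> for every compatible function, and the quadratic with
  gradient \<open>S + L (Y - X)\<close> attains it (\<open>guaranteed_decrease_eq\<close>); this parabola has its unique maximum at
  \<open>(\<sigma>\<^sub>1 - lam) / L\<close>.
\<close>

section \<open>Orthonormal eigenbases of symmetric matrices\<close>

definition orthonormal_basis :: "'a::euclidean_space set \<Rightarrow> bool" where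
  "orthonormal_basis E \<longleftrightarrow> pairwise orthogonal E \<and> (\<forall>e\<in>E. norm e = 1) \<and> span E = UNIV"

lemma orthonormal_basis_finite: "orthonormal_basis E \<Longrightarrow> finite E"
  unfolding orthonormal_basis_def by (blast intro: pairwise_orthogonal_imp_finite)

lemma inner_orthonormal_basis:
  assumes "orthonormal_basis E" "d \<in> E" "e \<in> E"
  shows "d \<bullet> e = (if d = e then 1 else 0)"
  using assms by (auto simp: orthonormal_basis_def pairwise_def orthogonal_def norm_eq_1)

lemma orthonormal_basis_expand_vector:
  fixes x :: "'a::euclidean_space"
  assumes E: "orthonormal_basis E"
  shows "x = (\<Sum>e\<in>E. (x \<bullet> e) *\<^sub>R e)"
  using E orthonormal_basis_finite[OF E] orthonormal_basis_expand[of E x]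
  by (auto simp: orthonormal_basis_def)

lemma orthonormal_basis_parseval:
  fixes x y :: "'a::euclidean_space"
  assumes E: "orthonormal_basis E"
  shows "x \<bullet> y = (\<Sum>e\<in>E. (x \<bullet> e) * (y \<bullet> e))"
proof -
  have "x \<bullet> y = x \<bullet> (\<Sum>e\<in>E. (y \<bullet> e) *\<^sub>R e)"
    using orthonormal_basis_expand_vector[OF E, of y] by simp
  then show ?thesis by (simp add: inner_sum_right mult.commute)
qed

text \<open>
  A maximizer \<open>e\<close> of the Rayleigh quotient on the unit sphere of \<open>T\<close> is an eigenvector: with the
  maximum \<open>\<mu>\<close>, the form \<open>\<mu> (x \<bullet> x) - x \<bullet> f x\<close> is nonnegative on \<open>T\<close> and vanishes at \<open>e\<close>, so its
  first variation at \<open>e\<close> in the direction of the residual \<open>f e - \<mu> e\<close> vanishes, and this variation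
  is a multiple of the squared length of the residual.
\<close>

lemma selfadjoint_unit_eigenvector:
  fixes f :: "'a::euclidean_space \<Rightarrow> 'a"
  assumes f: "linear f" and sym: "\<And>x y. x \<in> T \<Longrightarrow> y \<in> T \<Longrightarrow> f x \<bullet> y = x \<bullet> f y"
    and T: "subspace T" "f ` T \<subseteq> T" and nz: "T \<noteq> {0}"
  obtains e \<mu> where "e \<in> T" "norm e = 1" "f e = \<mu> *\<^sub>R e"
proof -
  obtain a where a: "a \<in> T" "a \<noteq> 0" using nz subspace_0[OF T(1)] by auto
  let ?K = "T \<inter> sphere 0 1"
  have "compact ?K"
    by (simp add: T closed_subspace closed_Int_compact)
  moreover have "(inverse (norm a)) *\<^sub>R a \<in> ?K"
    using a T(1) by (simp add: subspace_scale)
  moreover have "continuous_on ?K (\<lambda>x. x \<bullet> f x)"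
    using f by (intro continuous_intros linear_continuous_on) (simp add: linear_conv_bounded_linear)
  ultimately obtain e where e: "e \<in> ?K" and mx: "\<And>y. y \<in> ?K \<Longrightarrow> y \<bullet> f y \<le> e \<bullet> f e"
    using continuous_attains_sup[of ?K "\<lambda>x. x \<bullet> f x"] by blast
  define \<mu> where "\<mu> = e \<bullet> f e"
  have ee: "e \<in> T" "norm e = 1" "e \<bullet> e = 1" using e by (auto simp: norm_eq_1)
  have pos: "y \<bullet> f y \<le> \<mu> * (y \<bullet> y)" if y: "y \<in> T" for y
  proof (cases "y = 0")
    case True
    then show ?thesis by simp
  next
    case False
    let ?z = "inverse (norm y) *\<^sub>R y"
    have "?z \<in> ?K" using y False T(1) by (simp add: subspace_scale)
    then have "?z \<bullet> f ?z \<le> \<mu>" unfolding \<mu>_def by (rule mx)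
    then have "(y \<bullet> f y) / (norm y)\<^sup>2 \<le> \<mu>"
      by (simp add: linear_cmul[OF f] power2_eq_square divide_inverse mult_ac)
    then show ?thesis using False by (simp add: divide_le_eq power2_norm_eq_inner)
  qed
  define d where "d = f e - \<mu> *\<^sub>R e"
  have dT: "d \<in> T" using ee T by (auto simp: d_def intro!: subspace_diff subspace_scale)
  have "d \<bullet> d = 0"
  proof (rule ccontr)
    assume "d \<bullet> d \<noteq> 0"
    then have dd: "d \<bullet> d > 0" by (simp add: less_le)
    define q where "q = \<mu> * (d \<bullet> d) - d \<bullet> f d"
    (* nonnegativity of the form at e + t d, whose terms of order zero cancel *)
    have main: "2 * t * (d \<bullet> d) \<le> t\<^sup>2 * q" for t
    proof -
      have "e + t *\<^sub>R d \<in> T" using ee dT T by (simp add: subspace_add subspace_scale)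
      from pos[OF this]
      have "\<mu> + t * (e \<bullet> f d) + t * (d \<bullet> f e) + t\<^sup>2 * (d \<bullet> f d)
         \<le> \<mu> * (1 + 2 * t * (d \<bullet> e) + t\<^sup>2 * (d \<bullet> d))"
        by (simp add: linear_add[OF f] linear_cmul[OF f] inner_add_left inner_add_right
           \<mu>_def[symmetric] ee inner_commute[of e d] algebra_simps power2_eq_square)
      moreover have "e \<bullet> f d = d \<bullet> f e" using sym[OF ee(1) dT] by (simp add: inner_commute)
      moreover have "d \<bullet> f e = d \<bullet> d + \<mu> * (d \<bullet> e)"
        by (subst (3) d_def) (simp add: inner_diff_right)
      ultimately show ?thesis by (simp add: q_def algebra_simps)
    qed
    show False
    proof (cases "q \<le> 0")
      case True
      have "2 * (d \<bullet> d) \<le> q" using main[of 1] by simp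
      then show ?thesis using True dd by simp
    next
      case False
      have "2 * ((d \<bullet> d)\<^sup>2 / q) \<le> (d \<bullet> d)\<^sup>2 / q"
        using main[of "d \<bullet> d / q"] False by (simp add: power2_eq_square)
      moreover have "(d \<bullet> d)\<^sup>2 / q > 0" using dd False by simp
      ultimately show ?thesis by simp
    qed
  qed
  then have "f e = \<mu> *\<^sub>R e" by (simp add: d_def)
  with ee that show ?thesis by blast
qed

text \<open>
  The spectral theorem on an invariant subspace, by induction on the dimension: the orthogonal
  complement of one unit eigenvector is invariant again. Invariant subspaces occur in the statement
  for the sake of this induction.
\<close>

lemma selfadjoint_diagonalizable_on_subspace:
  fixes f :: "'a::euclidean_space \<Rightarrow> 'a"
  assumes f: "linear f" and sym: "\<And>x y. f x \<bullet> y = x \<bullet> f y"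
    and T: "subspace T" "f ` T \<subseteq> T"
  shows "\<exists>E. pairwise orthogonal E \<and> (\<forall>e\<in>E. norm e = 1 \<and> (\<exists>\<mu>. f e = \<mu> *\<^sub>R e)) \<and> span E = T"
  using T
proof (induction "dim T" arbitrary: T rule: less_induct)
  case less
  show ?case
  proof (cases "T = {0}")
    case True
    then show ?thesis by (intro exI[of _ "{}"]) auto
  next
    case False
    obtain e \<mu> where e: "e \<in> T" "norm e = 1" "f e = \<mu> *\<^sub>R e"
      using selfadjoint_unit_eigenvector[OF f sym less.prems False] by metis
    define T' where "T' = {x \<in> T. e \<bullet> x = 0}"
    have sub: "subspace T'"
      using less.prems(1) by (auto simp: T'_def subspace_def inner_add_right)
    have inv: "f ` T' \<subseteq> T'"
      using less.prems(2) sym[of e] e by (auto simp: T'_def) (metis inner_scaleR_left mult_zero_right)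
    have "e \<notin> T'" using e by (auto simp: T'_def)
    moreover have "T' \<subseteq> T" by (auto simp: T'_def)
    ultimately have "T' \<subset> T" using e by blast
    then have "dim T' < dim T"
      using sub less.prems(1) by (metis dim_psubset span_eq_iff)
    from less.hyps[OF this sub inv] obtain E where
      E: "pairwise orthogonal E" "\<forall>e\<in>E. norm e = 1 \<and> (\<exists>\<mu>. f e = \<mu> *\<^sub>R e)" "span E = T'" by blast
    have ET: "x \<in> T'" if "x \<in> E" for x using E(3) that span_base by blast
    have "span (insert e E) = T"
    proof
      show "span (insert e E) \<subseteq> T"
        using e ET less.prems(1) by (intro span_minimal) (auto simp: T'_def)
      show "T \<subseteq> span (insert e E)"
      proof
        fix x assume "x \<in> T"
        then have "x - (e \<bullet> x) *\<^sub>R e \<in> span E"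
          using e less.prems(1) by (simp add: E(3) T'_def subspace_diff subspace_scale
              inner_diff_right norm_eq_1)
        then show "x \<in> span (insert e E)" by (auto simp: span_insert)
      qed
    qed
    moreover have "pairwise orthogonal (insert e E)"
      using E(1) ET by (auto simp: pairwise_insert orthogonal_def T'_def inner_commute)
    ultimately show ?thesis using E(2) e by (intro exI[of _ "insert e E"]) auto
  qed
qed

lemma symmetric_matrix_diagonalizable:
  fixes M :: "real^'n^'n"
  assumes "transpose M = M"
  obtains E where "orthonormal_basis E" "\<And>e. e \<in> E \<Longrightarrow> \<exists>\<mu>. M *v e = \<mu> *\<^sub>R e"
proof -
  have "(M *v x) \<bullet> y = x \<bullet> (M *v y)" for x y
    by (metis assms dot_lmul_matrix transpose_matrix_vector)
  from selfadjoint_diagonalizable_on_subspace[OF matrix_vector_mul_linear this subspace_UNIV]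
  show ?thesis using that by (auto simp: orthonormal_basis_def)
qed

section \<open>The trace norm in a right singular basis\<close>

lemma inner_gram: "x \<bullet> ((transpose A ** A) *v y) = (A *v x) \<bullet> (A *v y)"
  for A :: "real^'m^'n"
  by (simp add: matrix_vector_mul_assoc[symmetric]) (metis dot_lmul_matrix inner_commute)

text \<open>
  An orthonormal eigenbasis of \<open>A\<^sup>T A\<close>. The eigenvalue of \<open>e\<close> is then necessarily
  \<open>e \<bullet> A\<^sup>T A e\<close>, the square of the length of \<open>A e\<close>; building this into the definition makes these
  lengths the nonzero singular values, with multiplicity, and zeros.
\<close>

definition right_singular_basis :: "real^'m^'n \<Rightarrow> (real^'m) set \<Rightarrow> bool" where
  "right_singular_basis A E \<longleftrightarrow> orthonormal_basis E \<and>
     (\<forall>e\<in>E. (transpose A ** A) *v e = (norm (A *v e))\<^sup>2 *\<^sub>R e)"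

lemma right_singular_basis_exists:
  fixes A :: "real^'m^'n"
  obtains E where "right_singular_basis A E"
proof -
  have "transpose (transpose A ** A) = transpose A ** A"
    by (simp add: matrix_transpose_mul)
  then obtain E where E: "orthonormal_basis E"
    and eig: "\<And>e. e \<in> E \<Longrightarrow> \<exists>\<mu>. (transpose A ** A) *v e = \<mu> *\<^sub>R e"
    using symmetric_matrix_diagonalizable by blast
  have "(transpose A ** A) *v e = (norm (A *v e))\<^sup>2 *\<^sub>R e" if "e \<in> E" for e
  proof -
    obtain \<mu> where \<mu>: "(transpose A ** A) *v e = \<mu> *\<^sub>R e" using eig[OF \<open>e \<in> E\<close>] by blast
    have "\<mu> = e \<bullet> ((transpose A ** A) *v e)"
      using inner_orthonormal_basis[OF E that that] by (simp only: \<mu>) simp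
    also have "\<dots> = (norm (A *v e))\<^sup>2" by (simp only: inner_gram power2_norm_eq_inner)
    finally show ?thesis using \<mu> by simp
  qed
  with E that show ?thesis by (auto simp: right_singular_basis_def)
qed

lemma right_singular_basis_images_orthogonal:
  fixes A :: "real^'m^'n"
  assumes "right_singular_basis A E" "d \<in> E" "e \<in> E" "d \<noteq> e"
  shows "(A *v d) \<bullet> (A *v e) = 0"
proof -
  have "(A *v d) \<bullet> (A *v e) = d \<bullet> ((transpose A ** A) *v e)" by (simp only: inner_gram)
  also have "\<dots> = (norm (A *v e))\<^sup>2 * (d \<bullet> e)"
    using assms by (simp add: right_singular_basis_def)
  also have "\<dots> = 0"
    using assms by (simp add: right_singular_basis_def inner_orthonormal_basis[of E])
  finally show ?thesis .
qed

text \<open>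
  Eigenvectors of the symmetric matrix \<open>A\<^sup>T A\<close> for different eigenvalues are orthogonal, so in the
  expansion of an eigenvector along the basis only members of the same eigenvalue survive.
\<close>

lemma gram_eigenspace_eq_span:
  fixes A :: "real^'m^'n"
  assumes E: "right_singular_basis A E" and s: "s \<ge> 0"
  shows "{v. (transpose A ** A) *v v = s\<^sup>2 *\<^sub>R v} = span {e \<in> E. norm (A *v e) = s}"
    (is "?V = span ?F")
proof
  have oE: "orthonormal_basis E" using E by (simp add: right_singular_basis_def)
  have "subspace ?V"
    by (auto simp: subspace_def matrix_vector_right_distrib matrix_vector_mult_scaleR scaleR_add_right)
  then show "span ?F \<subseteq> ?V"
    using E by (intro span_minimal) (auto simp: right_singular_basis_def)
  show "?V \<subseteq> span ?F"
  proof
    fix v assume "v \<in> ?V"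
    then have v: "(transpose A ** A) *v v = s\<^sup>2 *\<^sub>R v" by simp
    have "(v \<bullet> e) *\<^sub>R e \<in> span ?F" if e: "e \<in> E" for e
    proof (cases "norm (A *v e) = s")
      case True
      then show ?thesis using e by (simp add: span_base span_scale)
    next
      case False
      have "s\<^sup>2 * (v \<bullet> e) = e \<bullet> ((transpose A ** A) *v v)" by (simp only: v) (simp add: inner_commute)
      also have "\<dots> = v \<bullet> ((transpose A ** A) *v e)" by (simp only: inner_gram inner_commute)
      also have "\<dots> = (norm (A *v e))\<^sup>2 * (v \<bullet> e)"
        using E e by (simp add: right_singular_basis_def)
      finally have "v \<bullet> e = 0" using False s by simp
      then show ?thesis by (simp add: span_zero)
    qed
    then have "(\<Sum>e\<in>E. (v \<bullet> e) *\<^sub>R e) \<in> span ?F" by (rule span_sum)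
    then show "v \<in> span ?F" using orthonormal_basis_expand_vector[OF oE, of v] by simp
  qed
qed

text \<open>
  The value \<open>0\<close> has to be left out: if \<open>A\<close> has a kernel and \<open>A\<^sup>T\<close> has none, then \<open>0\<close> is the length
  of some \<open>A e\<close>, but there is no left singular vector for it.
\<close>

lemma singular_value_image:
  fixes A :: "real^'m^'n"
  assumes E: "right_singular_basis A E"
  shows "singular_values A - {0} = (\<lambda>e. norm (A *v e)) ` E - {0}"
proof (intro equalityI subsetI)
  have oE: "orthonormal_basis E" using E by (simp add: right_singular_basis_def)
  fix s assume "s \<in> singular_values A - {0}"
  then obtain u v where uv: "s > 0" "norm v = 1" "A *v v = s *\<^sub>R u" "transpose A *v u = s *\<^sub>R v"
    by (auto simp: singular_values_def singular_vectors_def)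
  have "(transpose A ** A) *v v = s\<^sup>2 *\<^sub>R v"
    by (simp only: matrix_vector_mul_assoc[symmetric] uv matrix_vector_mult_scaleR)
       (simp add: power2_eq_square)
  then have "v \<in> span {e \<in> E. norm (A *v e) = s}"
    using gram_eigenspace_eq_span[OF E, of s] uv by auto
  then have "{e \<in> E. norm (A *v e) = s} \<noteq> {}" using uv(2) by force
  then show "s \<in> (\<lambda>e. norm (A *v e)) ` E - {0}" using uv(1) by auto
next
  fix s assume "s \<in> (\<lambda>e. norm (A *v e)) ` E - {0}"
  then obtain e where e: "e \<in> E" "s = norm (A *v e)" "s > 0" by auto
  have "transpose A *v ((1/s) *\<^sub>R (A *v e)) = (1/s) *\<^sub>R ((transpose A ** A) *v e)"
    by (simp only: matrix_vector_mult_scaleR matrix_vector_mul_assoc)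
  also have "\<dots> = s *\<^sub>R e"
    using E e by (simp add: right_singular_basis_def power2_eq_square)
  finally have "singular_vectors A s ((1/s) *\<^sub>R (A *v e)) e"
    using e E by (simp add: singular_vectors_def right_singular_basis_def orthonormal_basis_def)
  then show "s \<in> singular_values A - {0}" using e by (auto simp: singular_values_def)
qed

text \<open>
  Counting the basis vectors according to the length of their images turns the multiplicities in the
  definition of the trace norm, which are dimensions of eigenspaces, into cardinalities.
\<close>

lemma trace_norm_eq_sum_norms:
  fixes A :: "real^'m^'n"
  assumes E: "right_singular_basis A E"
  shows "trace_norm A = (\<Sum>e\<in>E. norm (A *v e))"
proof -
  let ?s = "\<lambda>e. norm (A *v e)"
  have oE: "orthonormal_basis E" using E by (simp add: right_singular_basis_def)
  have fin[simp]: "finite E" by (rule orthonormal_basis_finite[OF oE])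
  have dim: "dim {v. (transpose A ** A) *v v = s\<^sup>2 *\<^sub>R v} = card {e \<in> E. ?s e = s}"
    if "s \<ge> 0" for s
  proof -
    have "independent {e \<in> E. ?s e = s}"
      using oE by (intro pairwise_orthogonal_independent)
        (auto simp: orthonormal_basis_def intro: pairwise_subset)
    then show ?thesis
      by (simp add: gram_eigenspace_eq_span[OF E that] dim_eq_card_independent)
  qed
  let ?g = "\<lambda>s. s * real (card {e \<in> E. ?s e = s})"
  have fin': "finite (singular_values A)"
  proof -
    have "finite (singular_values A - {0})" by (simp add: singular_value_image[OF E])
    then show ?thesis by simp
  qed
  have "trace_norm A = (\<Sum>s\<in>singular_values A. ?g s)"
    unfolding trace_norm_def
    by (rule sum.cong) (auto simp: dim singular_values_def singular_vectors_def)
  also have "\<dots> = (\<Sum>s\<in>singular_values A - {0}. ?g s)"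
    using fin' by (intro sum.mono_neutral_right) auto
  also have "\<dots> = (\<Sum>s\<in>?s ` E. ?g s)"
    unfolding singular_value_image[OF E] by (intro sum.mono_neutral_left) auto
  also have "\<dots> = (\<Sum>s\<in>?s ` E. \<Sum>e\<in>{e \<in> E. ?s e = s}. ?s e)"
    by (intro sum.cong) auto
  also have "\<dots> = (\<Sum>e\<in>E. ?s e)" by (rule sum.image_gen[symmetric]) simp
  finally show ?thesis .
qed

section \<open>Duality of the trace norm and the operator norm\<close>

definition contraction :: "real^'m^'n \<Rightarrow> bool" where
  "contraction W \<longleftrightarrow> (\<forall>x. norm (W *v x) \<le> norm x)"

lemma inner_matrix_eq_sum_basis:
  fixes W A :: "real^'m^'n"
  assumes E: "orthonormal_basis E"
  shows "W \<bullet> A = (\<Sum>e\<in>E. (W *v e) \<bullet> (A *v e))"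
proof -
  have "W \<bullet> A = (\<Sum>i\<in>UNIV. W $ i \<bullet> A $ i)" by (simp add: inner_vec_def)
  also have "\<dots> = (\<Sum>i\<in>UNIV. \<Sum>e\<in>E. (W $ i \<bullet> e) * (A $ i \<bullet> e))"
    by (simp add: orthonormal_basis_parseval[OF E, symmetric])
  also have "\<dots> = (\<Sum>e\<in>E. (W *v e) \<bullet> (A *v e))"
    by (subst sum.swap) (simp add: inner_vec_def[of "_ *v _"] matrix_vector_mul_component)
  finally show ?thesis .
qed

text \<open>
  Together with \<open>trace_norm_attained\<close> this is the duality between the trace norm and the operator
  norm, through which every statement about trace norms below is obtained.
\<close>

lemma inner_contraction_le_trace_norm:
  fixes W A :: "real^'m^'n"
  assumes "contraction W"
  shows "W \<bullet> A \<le> trace_norm A"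
proof -
  obtain E where E: "right_singular_basis A E" by (rule right_singular_basis_exists)
  then have oE: "orthonormal_basis E" by (simp add: right_singular_basis_def)
  have "(W *v e) \<bullet> (A *v e) \<le> norm (A *v e)" if "e \<in> E" for e
  proof -
    have "(W *v e) \<bullet> (A *v e) \<le> norm (W *v e) * norm (A *v e)" by (rule norm_cauchy_schwarz)
    also have "\<dots> \<le> norm e * norm (A *v e)"
      using assms by (intro mult_right_mono) (auto simp: contraction_def)
    finally show ?thesis using oE that by (simp add: orthonormal_basis_def)
  qed
  then show ?thesis
    unfolding inner_matrix_eq_sum_basis[OF oE] trace_norm_eq_sum_norms[OF E] by (rule sum_mono)
qed

lemma outer_mult_vector: "outer u v *v x = (v \<bullet> x) *\<^sub>R u"
  by (simp add: outer_def vec_eq_iff matrix_vector_mult_def inner_vec_def sum_distrib_left mult_ac)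

text \<open>
  The maximizing contraction is the partial isometry of the polar decomposition of \<open>A\<close>: it sends
  each vector \<open>e\<close> of a right singular basis to the direction of \<open>A e\<close>, and these directions are
  pairwise orthogonal. Basis vectors in the kernel of \<open>A\<close> are sent to \<open>sgn 0 = 0\<close>.
\<close>

lemma trace_norm_attained:
  fixes A :: "real^'m^'n"
  obtains W where "contraction W" "W \<bullet> A = trace_norm A"
proof -
  obtain E where E: "right_singular_basis A E" by (rule right_singular_basis_exists)
  then have oE: "orthonormal_basis E" by (simp add: right_singular_basis_def)
  have fin[simp]: "finite E" by (rule orthonormal_basis_finite[OF oE])
  define W where "W = (\<Sum>e\<in>E. outer (sgn (A *v e)) e)"
  have Wx: "W *v x = (\<Sum>e\<in>E. (e \<bullet> x) *\<^sub>R sgn (A *v e))" for x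
  proof -
    have "W *v x = (\<Sum>e\<in>E. outer (sgn (A *v e)) e *v x)"
      unfolding W_def by (induction E rule: infinite_finite_induct)
        (simp_all add: matrix_vector_mult_add_rdistrib)
    then show ?thesis by (simp add: outer_mult_vector)
  qed
  have "contraction W"
    unfolding contraction_def
  proof
    fix x
    have "(norm (W *v x))\<^sup>2 = (\<Sum>e\<in>E. (norm ((e \<bullet> x) *\<^sub>R sgn (A *v e)))\<^sup>2)"
      unfolding Wx
      by (rule norm_sum_Pythagorean)
        (auto simp: pairwise_def orthogonal_def sgn_div_norm
          right_singular_basis_images_orthogonal[OF E])
    also have "\<dots> \<le> (\<Sum>e\<in>E. (x \<bullet> e) * (x \<bullet> e))"
      by (intro sum_mono) (simp add: norm_sgn power2_eq_square inner_commute)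
    also have "\<dots> = (norm x)\<^sup>2"
      by (simp add: orthonormal_basis_parseval[OF oE, symmetric] power2_norm_eq_inner)
    finally show "norm (W *v x) \<le> norm x" by (simp add: power2_le_iff_abs_le)
  qed
  moreover have "(W *v e) \<bullet> (A *v e) = norm (A *v e)" if e: "e \<in> E" for e
  proof -
    have "W *v e = (\<Sum>d\<in>E. if d = e then sgn (A *v d) else 0)"
      unfolding Wx by (intro sum.cong) (auto simp: inner_orthonormal_basis[OF oE _ e])
    also have "\<dots> = sgn (A *v e)" using e by simp
    finally show ?thesis
      by (cases "A *v e = 0")
        (simp_all add: sgn_div_norm power2_norm_eq_inner[symmetric] power2_eq_square)
  qed
  ultimately show ?thesis
    using that[of W] unfolding inner_matrix_eq_sum_basis[OF oE] trace_norm_eq_sum_norms[OF E] by simp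
qed

section \<open>Matrices with orthonormal columns and the trace norm of a factorization\<close>

lemma inner_matrix_eq_trace: "W \<bullet> A = trace (transpose W ** A)"
  for W A :: "real^'m^'n"
  unfolding trace_def inner_vec_def matrix_matrix_mult_def transpose_def
  by (subst sum.swap) simp

lemma inner_matrix_mult_left: "W \<bullet> (C ** D) = (transpose C ** W) \<bullet> D"
  for W :: "real^'m^'n" and C :: "real^'k^'n"
  by (simp add: inner_matrix_eq_trace matrix_transpose_mul matrix_mul_assoc)

lemma inner_matrix_mult_right: "W \<bullet> (C ** D) = (W ** transpose D) \<bullet> C"
  for W :: "real^'m^'n" and C :: "real^'k^'n"
  using trace_mul_sym[of "transpose W ** C" D]
  by (simp add: inner_matrix_eq_trace matrix_transpose_mul matrix_mul_assoc)

lemma inner_matrix_outer: "W \<bullet> outer u v = u \<bullet> (W *v v)"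
  for W :: "real^'m^'n"
  by (simp add: outer_def inner_vec_def matrix_vector_mult_def sum_distrib_left mult_ac)

lemma norm_outer: "norm (outer u v) = norm u * norm v"
  for u :: "real^'n" and v :: "real^'m"
proof -
  have "(norm (outer u v))\<^sup>2 = (norm u * norm v)\<^sup>2"
    by (simp only: power2_norm_eq_inner inner_matrix_outer outer_mult_vector power_mult_distrib) simp
  then show ?thesis by simp
qed

lemma stiefel_inner: "U \<in> stiefel \<Longrightarrow> (U *v x) \<bullet> (U *v y) = x \<bullet> y"
  for U :: "real^'p^'n"
  by (simp add: stiefel_def flip: inner_gram)

lemma stiefel_norm: "U \<in> stiefel \<Longrightarrow> norm (U *v x) = norm x"
  for U :: "real^'p^'n"
  by (simp add: norm_eq_sqrt_inner stiefel_inner)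

lemma inner_transpose_mult: "(transpose A *v x) \<bullet> y = x \<bullet> (A *v y)"
  for A :: "real^'m^'n"
  by (simp add: dot_lmul_matrix)

lemma stiefel_transpose_norm_le:
  fixes U :: "real^'p^'n"
  assumes "U \<in> stiefel"
  shows "norm (transpose U *v x) \<le> norm x"
proof -
  let ?y = "transpose U *v x"
  have "norm ?y * norm ?y = x \<bullet> (U *v ?y)"
    by (simp only: inner_transpose_mult[symmetric] power2_norm_eq_inner[symmetric] power2_eq_square)
  also have "\<dots> \<le> norm x * norm ?y"
    using norm_cauchy_schwarz[of x "U *v ?y"] by (simp only: stiefel_norm[OF assms])
  finally show ?thesis by (cases "norm ?y = 0") (auto simp: mult_le_cancel_right)
qed

lemma sym_posdef_diagonalizable:
  fixes B :: "real^'p^'p"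
  assumes "B \<in> sym_posdef"
  obtains E \<mu> where "orthonormal_basis E" "\<And>e. e \<in> E \<Longrightarrow> B *v e = \<mu> e *\<^sub>R e"
    "\<And>e. e \<in> E \<Longrightarrow> \<mu> e > 0"
proof -
  obtain E where E: "orthonormal_basis E" "\<And>e. e \<in> E \<Longrightarrow> \<exists>\<mu>. B *v e = \<mu> *\<^sub>R e"
    using assms symmetric_matrix_diagonalizable[of B] by (auto simp: sym_posdef_def)
  then obtain \<mu> where \<mu>: "\<And>e. e \<in> E \<Longrightarrow> B *v e = \<mu> e *\<^sub>R e" by metis
  have "\<mu> e > 0" if "e \<in> E" for e
  proof -
    have ee: "e \<bullet> e = 1" using inner_orthonormal_basis[OF E(1) that that] by simp
    then have "e \<noteq> 0" by auto
    then have "e \<bullet> (B *v e) > 0" using assms by (auto simp: sym_posdef_def)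
    then show ?thesis by (simp add: \<mu>[OF that] ee)
  qed
  with E(1) \<mu> that show ?thesis by blast
qed

lemma inner_factored:
  "W \<bullet> (U ** B ** transpose V) = (transpose U ** W ** V) \<bullet> B"
  for W :: "real^'m^'n" and U :: "real^'p^'n" and B :: "real^'p^'p" and V :: "real^'p^'m"
  by (simp only: inner_matrix_mult_right[of W "U ** B" "transpose V"] transpose_transpose
      inner_matrix_mult_left[of _ U B] matrix_mul_assoc)

text \<open>
  By duality one compares \<open>\<langle>W, U B V\<^sup>T\<rangle> = \<langle>U\<^sup>T W V, B\<rangle>\<close> with \<open>\<langle>I, B\<rangle>\<close>, the trace of \<open>B\<close>. In an
  eigenbasis of \<open>B\<close> the first is a sum of the positive eigenvalues with weights at most \<open>1\<close>, and for
  \<open>W = U V\<^sup>T\<close> all weights are \<open>1\<close>.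
\<close>

lemma trace_norm_factored:
  fixes U :: "real^'p^'n" and B :: "real^'p^'p" and V :: "real^'p^'m"
  assumes U: "U \<in> stiefel" and B: "B \<in> sym_posdef" and V: "V \<in> stiefel"
  shows "trace_norm (U ** B ** transpose V) = trace B"
proof (rule antisym)
  have tr: "trace B = mat 1 \<bullet> B" by (simp add: inner_matrix_eq_trace)
  obtain E \<mu> where E: "orthonormal_basis E" "\<And>e. e \<in> E \<Longrightarrow> B *v e = \<mu> e *\<^sub>R e"
    "\<And>e. e \<in> E \<Longrightarrow> \<mu> e > 0"
    using sym_posdef_diagonalizable[OF B] by blast
  obtain W where W: "contraction W" "W \<bullet> (U ** B ** transpose V) = trace_norm (U ** B ** transpose V)"
    by (rule trace_norm_attained)
  have "((transpose U ** W ** V) *v e) \<bullet> (B *v e) \<le> (mat 1 *v e) \<bullet> (B *v e)" if e: "e \<in> E" for e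
  proof -
    have ne: "norm e = 1" using E(1) e by (simp add: orthonormal_basis_def)
    have "((transpose U ** W ** V) *v e) \<bullet> e = (W *v (V *v e)) \<bullet> (U *v e)"
      by (simp only: matrix_vector_mul_assoc[symmetric] inner_transpose_mult)
    also have "\<dots> \<le> norm (W *v (V *v e)) * norm (U *v e)" by (rule norm_cauchy_schwarz)
    also have "\<dots> \<le> norm (V *v e)"
      using W(1) by (simp add: stiefel_norm[OF U] ne contraction_def)
    also have "\<dots> = e \<bullet> e" using ne by (simp add: stiefel_norm[OF V] norm_eq_1)
    finally show ?thesis using E(3)[OF e] by (simp add: E(2)[OF e])
  qed
  then have "(transpose U ** W ** V) \<bullet> B \<le> mat 1 \<bullet> B"
    unfolding inner_matrix_eq_sum_basis[OF E(1)] by (rule sum_mono)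
  then show "trace_norm (U ** B ** transpose V) \<le> trace B"
    using W(2) by (simp only: tr inner_factored)
  have "contraction (U ** transpose V)"
    by (simp only: contraction_def matrix_vector_mul_assoc[symmetric] stiefel_norm[OF U]
        stiefel_transpose_norm_le[OF V] simp_thms)
  then have "(U ** transpose V) \<bullet> (U ** B ** transpose V) \<le> trace_norm (U ** B ** transpose V)"
    by (rule inner_contraction_le_trace_norm)
  moreover have "transpose U ** (U ** transpose V) ** V = mat 1"
    using U V by (simp add: stiefel_def matrix_mul_assoc)
  ultimately show "trace B \<le> trace_norm (U ** B ** transpose V)"
    by (simp only: inner_factored tr)
qed

text \<open>
  Since \<open>U B V\<^sup>T\<close> only sees \<open>W\<close> on the column space of \<open>V\<close>, every matrix that maps the columns of
  \<open>V\<close> to those of \<open>U\<close> gives the value of the trace norm. If it is a contraction, it is a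
  subgradient of the trace norm at \<open>U B V\<^sup>T\<close>.
\<close>

lemma inner_eq_trace_norm_factored:
  fixes U :: "real^'p^'n" and B :: "real^'p^'p" and V :: "real^'p^'m"
  assumes feasible: "U \<in> stiefel" "B \<in> sym_posdef" "V \<in> stiefel" and W: "W ** V = U"
  shows "W \<bullet> (U ** B ** transpose V) = trace_norm (U ** B ** transpose V)"
proof -
  have "transpose U ** W ** V = mat 1"
    using feasible(1) by (simp add: matrix_mul_assoc[symmetric] W stiefel_def)
  then show ?thesis
    by (simp only: inner_factored trace_norm_factored[OF feasible])
      (simp add: inner_matrix_eq_trace)
qed

lemma dominant_bounds_operator:
  fixes A :: "real^'m^'n"
  assumes "dominant_singular_vectors A s u v"
  shows "norm (A *v x) \<le> s * norm x"
proof -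
  obtain E where E: "right_singular_basis A E" by (rule right_singular_basis_exists)
  then have oE: "orthonormal_basis E" by (simp add: right_singular_basis_def)
  have s: "s \<ge> 0" "\<And>t. t \<in> singular_values A \<Longrightarrow> t \<le> s"
    using assms by (auto simp: dominant_singular_vectors_def singular_vectors_def)
  have le: "norm (A *v e) \<le> s" if "e \<in> E" for e
  proof (cases "A *v e = 0")
    case False
    then have "norm (A *v e) \<in> (\<lambda>e. norm (A *v e)) ` E - {0}" using that by auto
    then show ?thesis using s(2) by (simp only: singular_value_image[OF E, symmetric]) blast
  qed (simp add: s)
  have "(norm (A *v x))\<^sup>2 = x \<bullet> ((transpose A ** A) *v x)"
    by (simp only: inner_gram power2_norm_eq_inner)
  also have "\<dots> = (\<Sum>e\<in>E. (x \<bullet> e) * (((transpose A ** A) *v x) \<bullet> e))"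
    by (rule orthonormal_basis_parseval[OF oE])
  also have "\<dots> = (\<Sum>e\<in>E. (norm (A *v e))\<^sup>2 * (x \<bullet> e)\<^sup>2)"
  proof (intro sum.cong refl)
    fix e assume e: "e \<in> E"
    have "((transpose A ** A) *v x) \<bullet> e = x \<bullet> ((transpose A ** A) *v e)"
      by (simp only: inner_gram inner_commute[of _ e] inner_commute[of _ "A *v e"])
    also have "\<dots> = (norm (A *v e))\<^sup>2 * (x \<bullet> e)" using E e by (simp add: right_singular_basis_def)
    finally show "(x \<bullet> e) * (((transpose A ** A) *v x) \<bullet> e) = (norm (A *v e))\<^sup>2 * (x \<bullet> e)\<^sup>2"
      by (simp add: power2_eq_square)
  qed
  also have "\<dots> \<le> (\<Sum>e\<in>E. s\<^sup>2 * (x \<bullet> e)\<^sup>2)"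
    using le by (intro sum_mono mult_right_mono power_mono) auto
  also have "\<dots> = (s * norm x)\<^sup>2"
    by (simp add: sum_distrib_left[symmetric] power_mult_distrib power2_norm_eq_inner
        orthonormal_basis_parseval[OF oE, of x x]) (simp add: power2_eq_square)
  finally show ?thesis by (rule power2_le_imp_le) (simp add: s)
qed

section \<open>The dual variable at a stationary point\<close>

lemma matrix_zero_if_zero_on_basis:
  fixes D :: "real^'m^'n"
  assumes "orthonormal_basis E" "\<And>e. e \<in> E \<Longrightarrow> D *v e = 0"
  shows "D = 0"
proof -
  have "D \<bullet> D = 0" using assms by (simp add: inner_matrix_eq_sum_basis[OF assms(1)])
  then show ?thesis by simp
qed

text \<open>
  The first-order conditions, with \<open>B\<close> cancelled, say that \<open>T = U\<^sup>T S V\<close> satisfies \<open>S V = U T\<close>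
  and \<open>S\<^sup>T U = V T\<^sup>T\<close>, that \<open>T B\<close> is symmetric and that \<open>K = T + lam I\<close> is skew.
  Symmetry of \<open>T B\<close> then reads \<open>B K = - K B\<close>, so \<open>K\<close> maps an eigenvector of \<open>B\<close> for \<open>\<mu> > 0\<close> to one for \<open>- \<mu> < 0\<close>, hence to zero. Thus
  \<open>T = - lam I\<close>: on the column space of \<open>V\<close>, the dual variable acts as \<open>- lam U V\<^sup>T\<close>,
  and its transpose on that of \<open>U\<close> as \<open>- lam V U\<^sup>T\<close>.
\<close>

lemma stationary_point_dual:
  fixes U :: "real^'p^'n" and B :: "real^'p^'p" and V :: "real^'p^'m"
  assumes st: "stationary_point G lam U B V" and S: "S = G (U ** B ** transpose V)"
  shows "S *v (V *v x) = - lam *\<^sub>R (U *v x)" "transpose S *v (U *v x) = - lam *\<^sub>R (V *v x)"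
proof -
  have U: "transpose U ** U = mat 1" and V: "transpose V ** V = mat 1" and B: "B \<in> sym_posdef"
    using st by (auto simp: stationary_point_def stiefel_def)
  have BT: "transpose B = B" using B by (simp add: sym_posdef_def)
  define T where "T = transpose U ** S ** V"
  define M where "M = sym_part (transpose U ** S ** V ** B)"
  define N where "N = sym_part (transpose V ** transpose S ** U ** B)"
  have TT: "transpose T = transpose V ** transpose S ** U"
    by (simp add: T_def matrix_transpose_mul matrix_mul_assoc)
  have eqs: "S ** V ** B = U ** M" "transpose S ** U ** B = V ** N"
      "sym_part (T + lam *\<^sub>R mat 1) = 0"
    using st by (simp_all add: stationary_point_def Let_def S[symmetric] M_def N_def T_def)
  have sym: "transpose (sym_part D) = sym_part D" for D :: "real^'p^'p"
    by (simp add: sym_part_def vec_eq_iff transpose_def add.commute)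
  have "T ** B = transpose U ** (S ** V ** B)" by (simp add: T_def matrix_mul_assoc)
  then have TB: "T ** B = M" by (simp add: eqs matrix_mul_assoc U)
  have "transpose T ** B = transpose V ** (transpose S ** U ** B)" by (simp add: TT matrix_mul_assoc)
  then have TB': "transpose T ** B = N" by (simp add: eqs matrix_mul_assoc V)
  have "transpose M = M" by (simp add: M_def sym)
  then have BT': "B ** transpose T = T ** B"
    using matrix_transpose_mul[of T B] by (simp add: TB BT)
  define K where "K = T + lam *\<^sub>R mat 1"
  have skew: "transpose K = - K"
    using eqs(3) by (simp add: K_def[symmetric] sym_part_def eq_neg_iff_add_eq_0 add.commute)
  have T: "T = K - lam *\<^sub>R mat 1" "transpose T = - K - lam *\<^sub>R mat 1"
  proof -
    show "T = K - lam *\<^sub>R mat 1" by (simp add: K_def)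
    have "transpose K = transpose T + lam *\<^sub>R mat 1"
      by (auto simp: K_def vec_eq_iff transpose_def mat_def)
    then show "transpose T = - K - lam *\<^sub>R mat 1" by (simp add: skew)
  qed
  obtain E \<mu> where E: "orthonormal_basis E" "\<And>e. e \<in> E \<Longrightarrow> B *v e = \<mu> e *\<^sub>R e"
    "\<And>e. e \<in> E \<Longrightarrow> \<mu> e > 0"
    using sym_posdef_diagonalizable[OF B] by blast
  have mm: "(C - lam *\<^sub>R mat 1) *v y = C *v y - lam *\<^sub>R y" for C :: "real^'p^'p" and y
    by (simp add: matrix_vector_mult_diff_rdistrib scaleR_matrix_vector_assoc[symmetric])
  have neg: "(- C) *v y = - (C *v y)" for C :: "real^'p^'p" and y
    using matrix_vector_mult_diff_rdistrib[of 0 C y] by simp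
  have "K *v e = 0" if e: "e \<in> E" for e
  proof (rule ccontr)
    let ?z = "K *v e"
    assume "?z \<noteq> 0"
    then have "?z \<bullet> (B *v ?z) > 0" using B by (auto simp: sym_posdef_def)
    have "B *v (transpose T *v e) = T *v (B *v e)"
      by (simp only: matrix_vector_mul_assoc BT')
    then have "B *v (- ?z - lam *\<^sub>R e) = K *v (\<mu> e *\<^sub>R e) - lam *\<^sub>R (\<mu> e *\<^sub>R e)"
      by (simp only: T(2)) (simp only: T(1) mm neg E(2)[OF e])
    then have "B *v ?z = - \<mu> e *\<^sub>R ?z"
      by (simp add: E(2)[OF e] linear_neg[OF matrix_vector_mul_linear] algebra_simps)
        (metis minus_minus)
    then have "?z \<bullet> (B *v ?z) = - \<mu> e * (?z \<bullet> ?z)" by simp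
    also have "\<dots> \<le> 0" using E(3)[OF e] by (simp add: mult_nonneg_nonneg)
    finally show False using \<open>?z \<bullet> (B *v ?z) > 0\<close> by simp
  qed
  then have "K = 0" by (rule matrix_zero_if_zero_on_basis[OF E(1)])
  then have Tl: "T = - lam *\<^sub>R mat 1" "transpose T = - lam *\<^sub>R mat 1" using T by auto
  (* B is invertible *)
  have cancel: "P = Q" if PQ: "P ** B = Q ** B" for P Q :: "real^'p^'k"
  proof -
    have "(P - Q) *v e = 0" if e: "e \<in> E" for e
    proof -
      have "P *v (B *v e) = Q *v (B *v e)" by (simp only: matrix_vector_mul_assoc PQ)
      then show ?thesis using E(3)[OF e]
        by (simp add: E(2)[OF e] matrix_vector_mult_scaleR matrix_vector_mult_diff_rdistrib)
    qed
    then have "P - Q = 0" by (rule matrix_zero_if_zero_on_basis[OF E(1)])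
    then show ?thesis by simp
  qed
  have "S ** V = U ** T"
    by (rule cancel) (simp only: eqs matrix_mul_assoc[of U T B, symmetric] TB)
  then have "(S ** V) *v x = U *v (T *v x)" by (simp add: matrix_vector_mul_assoc)
  then show "S *v (V *v x) = - lam *\<^sub>R (U *v x)"
    unfolding Tl(1)
    by (simp only: matrix_vector_mul_assoc[symmetric] scaleR_matrix_vector_assoc[symmetric]
        matrix_vector_mult_scaleR matrix_vector_mul_lid)
  have "transpose S ** U = V ** transpose T"
    by (rule cancel) (simp only: eqs matrix_mul_assoc[of V "transpose T" B, symmetric] TB')
  then have "(transpose S ** U) *v x = V *v (transpose T *v x)" by (simp only: matrix_vector_mul_assoc)
  then show "transpose S *v (U *v x) = - lam *\<^sub>R (V *v x)"
    unfolding Tl(2)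
    by (simp only: matrix_vector_mul_assoc[symmetric] scaleR_matrix_vector_assoc[symmetric]
        matrix_vector_mult_scaleR matrix_vector_mul_lid)
qed

section \<open>Smooth convex functions\<close>

lemma gderiv_along_line:
  fixes f :: "'a::real_inner \<Rightarrow> real"
  assumes "\<And>Y. GDERIV f Y :> G Y"
  shows "((\<lambda>t. f (X + t *\<^sub>R D)) has_real_derivative D \<bullet> G (X + t *\<^sub>R D)) (at t)"
proof -
  have "((\<lambda>t. X + t *\<^sub>R D) has_derivative (\<lambda>h. h *\<^sub>R D)) (at t)"
    by (auto intro!: derivative_eq_intros)
  from has_derivative_compose[OF this, of f "\<lambda>h. h \<bullet> G (X + t *\<^sub>R D)"] assms
  show ?thesis by (simp add: gderiv_def has_field_derivative_def
      mult.commute[of _ "D \<bullet> _"] mult_commute_abs)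
qed

lemma convex_above_gradient_plane:
  fixes f :: "'a::real_inner \<Rightarrow> real"
  assumes f: "convex_on UNIV f" and G: "\<And>Y. GDERIV f Y :> G Y"
  shows "f X + (Y - X) \<bullet> G X \<le> f Y"
proof -
  let ?g = "\<lambda>t. f (X + t *\<^sub>R (Y - X))"
  have "convex_on UNIV ?g"
  proof (intro convex_onI)
    fix t x y :: real assume "0 < t" "t < 1"
    then show "?g ((1 - t) *\<^sub>R x + t *\<^sub>R y) \<le> (1 - t) * ?g x + t * ?g y"
      using convex_onD[OF f, of t "X + x *\<^sub>R (Y - X)" "X + y *\<^sub>R (Y - X)"]
      by (simp add: algebra_simps)
  qed auto
  from convex_on_imp_above_tangent[OF this _ _ _ gderiv_along_line[OF G], of 0 1]
  show ?thesis by simp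
qed

text \<open>
  The remainder of the quadratic upper model decreases along the segment from \<open>X\<close> to \<open>X + D\<close>: its
  derivative at \<open>t\<close> is \<open>\<langle>D, G (X + t D) - G X\<rangle> - L t \<parallel>D\<parallel>\<^sup>2\<close>, which is nonpositive by Cauchy-Schwarz
  and the Lipschitz bound.
\<close>

lemma descent_lemma:
  fixes f :: "real^'m^'n \<Rightarrow> real"
  assumes G: "\<And>Y. GDERIV f Y :> G Y" and L: "lipschitz_gradient L G"
  shows "f (X + D) \<le> f X + D \<bullet> G X + L / 2 * (norm D)\<^sup>2"
proof -
  define g where "g t = f (X + t *\<^sub>R D) - t * (D \<bullet> G X) - L / 2 * t\<^sup>2 * (norm D)\<^sup>2" for t
  have g': "(g has_real_derivative D \<bullet> G (X + t *\<^sub>R D) - D \<bullet> G X - L * t * (norm D)\<^sup>2) (at t)" for t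
    unfolding g_def
    by (rule derivative_eq_intros gderiv_along_line[OF G] refl | simp)+
  have "g 1 \<le> g 0"
  proof (rule DERIV_nonpos_imp_nonincreasing[of 0 1 g])
    fix t :: real assume t: "0 \<le> t" "t \<le> 1"
    have "D \<bullet> G (X + t *\<^sub>R D) - D \<bullet> G X = D \<bullet> (G (X + t *\<^sub>R D) - G X)"
      by (simp add: inner_diff_right)
    also have "\<dots> \<le> norm D * norm (G (X + t *\<^sub>R D) - G X)" by (rule norm_cauchy_schwarz)
    also have "\<dots> \<le> norm D * (L * norm (t *\<^sub>R D))"
      using L[unfolded lipschitz_gradient_def, rule_format, of "X + t *\<^sub>R D" X]
      by (intro mult_left_mono) simp_all
    also have "\<dots> = L * t * (norm D)\<^sup>2" using t by (simp add: power2_eq_square)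
    finally show "\<exists>y. DERIV g t :> y \<and> y \<le> 0" using g'[of t] by (intro exI conjI) auto
  qed simp
  then show ?thesis by (simp add: g_def)
qed

text \<open>
  The convex quadratic for which the descent lemma is an equality. It makes the worst-case decrease
  an attained minimum.
\<close>

lemma quadratic_compatible:
  fixes X S :: "real^'m^'n"
  assumes L: "L > 0"
  shows "(\<lambda>Y. (Y - X) \<bullet> S + L / 2 * ((Y - X) \<bullet> (Y - X))) \<in> compatible_functions L X S"
    (is "?h \<in> _")
proof -
  have "convex_on UNIV ?h"
  proof (intro convex_onI)
    fix t :: real and x y :: "real^'m^'n" assume t: "0 < t" "t < 1"
    have "(1 - t) * ?h x + t * ?h y - ?h ((1 - t) *\<^sub>R x + t *\<^sub>R y)
        = L / 2 * (t * (1 - t) * ((x - y) \<bullet> (x - y)))"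
      by (simp add: algebra_simps inner_commute power2_eq_square inner_add_left
          inner_add_right inner_diff_left inner_diff_right)
        (simp add: field_simps)
    also have "\<dots> \<ge> 0" using t L by simp
    finally show "?h ((1 - t) *\<^sub>R x + t *\<^sub>R y) \<le> (1 - t) * ?h x + t * ?h y" by simp
  qed simp
  moreover have "GDERIV ?h Y :> S + L *\<^sub>R (Y - X)" for Y
    unfolding gderiv_def
    by (rule derivative_eq_intros refl
        | simp add: fun_eq_iff inner_add_right inner_diff_right inner_diff_left
            inner_commute algebra_simps)+
  moreover have "lipschitz_gradient L (\<lambda>Y. S + L *\<^sub>R (Y - X))"
    using L by (simp add: lipschitz_gradient_def flip: scaleR_diff_right)
  ultimately show ?thesis
    unfolding compatible_functions_def by (auto intro!: exI[of _ "\<lambda>Y. S + L *\<^sub>R (Y - X)"])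
qed

section \<open>The rank-one step\<close>

lemma trace_norm_rank_one_le:
  fixes X :: "real^'m^'n"
  assumes "norm u = 1" "norm v = 1" "b \<ge> 0"
  shows "trace_norm (X - b *\<^sub>R outer u v) \<le> trace_norm X + b"
proof -
  obtain W where W: "contraction W"
    "W \<bullet> (X - b *\<^sub>R outer u v) = trace_norm (X - b *\<^sub>R outer u v)"
    by (rule trace_norm_attained)
  have "- (u \<bullet> (W *v v)) \<le> norm u * norm (W *v v)"
    using norm_cauchy_schwarz[of "-u" "W *v v"] by simp
  also have "\<dots> \<le> 1" using W(1) assms by (simp add: contraction_def) metis
  finally have "b * - (u \<bullet> (W *v v)) \<le> b * 1" using assms by (intro mult_left_mono)
  moreover have "W \<bullet> X \<le> trace_norm X" by (rule inner_contraction_le_trace_norm[OF W(1)])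
  ultimately show ?thesis
    using W(2) by (simp add: inner_diff_right inner_matrix_outer)
qed

text \<open>
  As the trace norm grows by exactly \<open>b\<close>, the decrease depends on a compatible function only through
  its own drop along the step. The descent lemma bounds this drop from below, and the quadratic model
  attains the bound.
\<close>

lemma guaranteed_decrease_eq:
  fixes X S :: "real^'m^'n"
  assumes L: "L > 0" and uv: "norm u = 1" "norm v = 1" "u \<bullet> (S *v v) = s"
    and tn: "trace_norm (X - b *\<^sub>R outer u v) = trace_norm X + b"
  shows "guaranteed_decrease lam L X S u v b = b * (s - lam - L / 2 * b)"
    and "h \<in> compatible_functions L X S \<Longrightarrow>
      guaranteed_decrease lam L X S u v b \<le> objective h lam X - objective h lam (X - b *\<^sub>R outer u v)"
proof -
  let ?d = "\<lambda>h. objective h lam X - objective h lam (X - b *\<^sub>R outer u v)"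
  have d: "?d h = h X - h (X - b *\<^sub>R outer u v) - lam * b" for h
    by (simp add: objective_def tn algebra_simps)
  have lower: "b * (s - lam - L / 2 * b) \<le> ?d h" if h: "h \<in> compatible_functions L X S" for h
  proof -
    obtain H where H: "\<And>Y. GDERIV h Y :> H Y" "lipschitz_gradient L H" "H X = S"
      using h unfolding compatible_functions_def by blast
    show ?thesis
      using descent_lemma[OF H(1,2), of X "- b *\<^sub>R outer u v"] uv
      by (simp add: d H(3) norm_outer inner_commute[of _ S] inner_matrix_outer
          power2_eq_square algebra_simps)
  qed
  define q where "q Y = (Y - X) \<bullet> S + L / 2 * ((Y - X) \<bullet> (Y - X))" for Y
  have q: "q \<in> compatible_functions L X S"
    unfolding q_def by (rule quadratic_compatible[OF L])
  have "outer u v \<bullet> outer u v = 1" using uv norm_outer[of u v] by (simp add: norm_eq_1[symmetric])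
  moreover have "outer u v \<bullet> S = s" using uv by (simp add: inner_commute[of _ S] inner_matrix_outer)
  ultimately have dq: "?d q = b * (s - lam - L / 2 * b)"
    by (simp add: d q_def algebra_simps)
  have bdd: "bdd_below (?d ` compatible_functions L X S)"
    using lower by (intro bdd_belowI2)
  show "guaranteed_decrease lam L X S u v b = b * (s - lam - L / 2 * b)"
    unfolding guaranteed_decrease_def
  proof (rule antisym)
    show "(INF h\<in>compatible_functions L X S. ?d h) \<le> b * (s - lam - L / 2 * b)"
      using cINF_lower[OF bdd q] by (simp only: dq)
    show "b * (s - lam - L / 2 * b) \<le> (INF h\<in>compatible_functions L X S. ?d h)"
      using q lower by (intro cINF_greatest) auto
  qed
  show "guaranteed_decrease lam L X S u v b \<le> ?d h" if "h \<in> compatible_functions L X S"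
    unfolding guaranteed_decrease_def by (rule cINF_lower[OF bdd that])
qed

lemma orthogonal_extension_contraction:
  fixes U :: "real^'p^'n" and V :: "real^'p^'m"
  assumes U: "U \<in> stiefel" and V: "V \<in> stiefel" and uv: "norm u = 1" "norm v = 1"
    and uU: "\<And>y. u \<bullet> (U *v y) = 0" and vV: "\<And>y. v \<bullet> (V *v y) = 0"
  shows "contraction (U ** transpose V - outer u v)"
  unfolding contraction_def
proof
  fix x
  define y where "y = transpose V *v x"
  let ?W = "U ** transpose V - outer u v"
  (* the component of x orthogonal to v and to the columns of V *)
  let ?r = "x - V *v y - (v \<bullet> x) *\<^sub>R v"
  have Vy: "x \<bullet> (V *v y) = y \<bullet> y" "(V *v y) \<bullet> x = y \<bullet> y"
    unfolding y_def by (simp_all only: inner_transpose_mult inner_commute[of "V *v _" x])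
  have uU': "(U *v y) \<bullet> u = 0" and vV': "(V *v y) \<bullet> v = 0" for y
    using uU vV by (simp_all add: inner_commute)
  have "?W *v x = U *v y - (v \<bullet> x) *\<^sub>R u"
    by (simp only: y_def matrix_vector_mult_diff_rdistrib matrix_vector_mul_assoc outer_mult_vector)
  then have "(norm (?W *v x))\<^sup>2 = y \<bullet> y + (v \<bullet> x)\<^sup>2"
    using uv(1) unfolding power2_norm_eq_inner
    by (simp add: inner_diff_left inner_diff_right uU uU'
        stiefel_inner[OF U] norm_eq_1 power2_eq_square)
  moreover have "?r \<bullet> ?r = x \<bullet> x - y \<bullet> y - (v \<bullet> x)\<^sup>2"
    using uv(2) by (simp add: inner_diff_left inner_diff_right vV vV' Vy inner_commute[of x v]
        stiefel_inner[OF V] norm_eq_1 power2_eq_square)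
  moreover have "0 \<le> ?r \<bullet> ?r" by (rule inner_ge_zero)
  ultimately have "(norm (?W *v x))\<^sup>2 \<le> (norm x)\<^sup>2" by (simp add: power2_norm_eq_inner[of x])
  then show "norm (?W *v x) \<le> norm x" by (rule power2_le_imp_le) simp
qed

context
  fixes U :: "real^'p^'n" and B :: "real^'p^'p" and V :: "real^'p^'m"
    and S X :: "real^'m^'n" and lam s :: real and u :: "real^'n" and v :: "real^'m"
  assumes lam: "lam > 0" and U: "U \<in> stiefel" and B: "B \<in> sym_posdef" and V: "V \<in> stiefel"
    and SV: "\<And>x. S *v (V *v x) = - lam *\<^sub>R (U *v x)"
    and SU: "\<And>x. transpose S *v (U *v x) = - lam *\<^sub>R (V *v x)"
    and dom: "dominant_singular_vectors S s u v"
    and X: "X = U ** B ** transpose V"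
begin

lemma regularization_le_dominant: "lam \<le> s"
proof -
  obtain x :: "real^'p" where x: "norm x = 1" using vector_choose_size[of 1] by auto
  have "lam = norm (S *v (V *v x))" using lam by (simp add: SV stiefel_norm[OF U] x)
  also have "\<dots> \<le> s"
    using dominant_bounds_operator[OF dom, of "V *v x"] by (simp add: stiefel_norm[OF V] x)
  finally show ?thesis .
qed

lemma dual_variable_subgradient:
  assumes "s = lam"
  shows "contraction ((- 1 / lam) *\<^sub>R S)" "(- 1 / lam) *\<^sub>R S \<bullet> X = trace_norm X"
proof -
  show "contraction ((- 1 / lam) *\<^sub>R S)"
    using dominant_bounds_operator[OF dom] lam assms
    by (simp only: contraction_def scaleR_matrix_vector_assoc[symmetric] norm_scaleR)
      (simp add: field_simps)
  have "((- 1 / lam) *\<^sub>R S) ** V = U"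
    using lam by (simp only: matrix_eq matrix_vector_mul_assoc[symmetric]
        scaleR_matrix_vector_assoc[symmetric] SV) simp
  then show "(- 1 / lam) *\<^sub>R S \<bullet> X = trace_norm X"
    unfolding X by (rule inner_eq_trace_norm_factored[OF U B V])
qed

text \<open>
  The columns of \<open>V\<close> and of \<open>U\<close> are singular directions of \<open>S\<close> for the value \<open>lam\<close>, and \<open>v\<close>, \<open>u\<close>
  are so for \<open>s\<close>; different singular values have orthogonal directions. The two relations between
  \<open>u \<bullet> U y\<close> and \<open>v \<bullet> V y\<close> decouple for their sum and difference.
\<close>

lemma dominant_orthogonal_to_factors:
  assumes "s > lam"
  shows "u \<bullet> (U *v y) = 0" "v \<bullet> (V *v y) = 0"
proof -
  have uv: "S *v v = s *\<^sub>R u" "transpose S *v u = s *\<^sub>R v"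
    using dom by (auto simp: dominant_singular_vectors_def singular_vectors_def)
  have "s * (u \<bullet> (U *v y)) = (S *v v) \<bullet> (U *v y)" by (simp add: uv)
  also have "\<dots> = v \<bullet> (transpose S *v (U *v y))"
    by (metis inner_commute inner_transpose_mult)
  finally have 1: "s * (u \<bullet> (U *v y)) = - lam * (v \<bullet> (V *v y))"
    by (simp only: SU inner_scaleR_right)
  have "s * (v \<bullet> (V *v y)) = (transpose S *v u) \<bullet> (V *v y)" by (simp only: uv inner_scaleR_left)
  also have "\<dots> = u \<bullet> (S *v (V *v y))" by (rule inner_transpose_mult)
  finally have 2: "s * (v \<bullet> (V *v y)) = - lam * (u \<bullet> (U *v y))"
    by (simp only: SV inner_scaleR_right)
  have "(s + lam) * (u \<bullet> (U *v y) + v \<bullet> (V *v y)) = 0"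
    "(s - lam) * (u \<bullet> (U *v y) - v \<bullet> (V *v y)) = 0"
    using 1 2 by (simp_all add: algebra_simps)
  then show "u \<bullet> (U *v y) = 0" "v \<bullet> (V *v y) = 0" using assms lam by auto
qed

text \<open>
  At most \<open>b\<close> is added to the trace norm because \<open>u v\<^sup>T\<close> has trace norm \<open>1\<close>. That all of \<open>b\<close> is
  added is certified by a subgradient \<open>W\<close> of the trace norm at \<open>X\<close> with \<open>\<langle>W, u v\<^sup>T\<rangle> = - 1\<close>: if
  \<open>s > lam\<close>, the new direction is orthogonal to the factors and \<open>W = U V\<^sup>T - u v\<^sup>T\<close> works; if
  \<open>s = lam\<close>, the direction may lie in the column spaces of the factors, but \<open>W = - S / lam\<close> works.
\<close>

lemma trace_norm_rank_one_step:
  assumes b: "b \<ge> 0"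
  shows "trace_norm (X - b *\<^sub>R outer u v) = trace_norm X + b"
proof -
  have uv: "norm u = 1" "norm v = 1" "S *v v = s *\<^sub>R u"
    using dom by (auto simp: dominant_singular_vectors_def singular_vectors_def)
  obtain W where W: "contraction W" "W \<bullet> X = trace_norm X" "u \<bullet> (W *v v) = - 1"
  proof (cases "s = lam")
    case True
    have "u \<bullet> (((- 1 / lam) *\<^sub>R S) *v v) = - 1"
      using True uv lam by (simp only: scaleR_matrix_vector_assoc[symmetric]) (simp add: norm_eq_1)
    then show ?thesis using that dual_variable_subgradient[OF True] by blast
  next
    case False
    then have s: "s > lam" using regularization_le_dominant by simp
    note perp = dominant_orthogonal_to_factors[OF s]
    define W where "W = U ** transpose V - outer u v"
    have Wx: "W *v x = U *v (transpose V *v x) - (v \<bullet> x) *\<^sub>R u" for x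
      by (simp only: W_def matrix_vector_mult_diff_rdistrib matrix_vector_mul_assoc outer_mult_vector)
    have "contraction W"
      unfolding W_def by (rule orthogonal_extension_contraction[OF U V uv(1,2) perp])
    moreover have "W ** V = U"
    proof -
      have "transpose V *v (V *v x) = x" for x
        using V by (simp only: stiefel_def mem_Collect_eq matrix_vector_mul_assoc matrix_vector_mul_lid)
      then show ?thesis
        by (simp only: matrix_eq matrix_vector_mul_assoc[symmetric] Wx perp) simp
    qed
    then have "W \<bullet> X = trace_norm X"
      unfolding X by (rule inner_eq_trace_norm_factored[OF U B V])
    moreover have "u \<bullet> (W *v v) = - 1"
      using uv by (simp only: Wx inner_diff_right perp) (simp add: norm_eq_1)
    ultimately show ?thesis by (rule that)
  qed
  have "trace_norm X + b \<le> trace_norm (X - b *\<^sub>R outer u v)"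
    using inner_contraction_le_trace_norm[OF W(1), of "X - b *\<^sub>R outer u v"] W
    by (simp add: inner_diff_right inner_matrix_outer)
  with trace_norm_rank_one_le[OF uv(1,2) b, of X] show ?thesis by simp
qed

end

theorem proposition4p1:
  fixes f :: "real^'m^'n \<Rightarrow> real" and G :: "real^'m^'n \<Rightarrow> real^'m^'n"
    and U :: "real^'p^'n" and B :: "real^'p^'p" and V :: "real^'p^'m"
    and X S :: "real^'m^'n" and u :: "real^'n" and v :: "real^'m"
    and lam \<sigma>\<^sub>1 :: real
  assumes convex: "convex_on UNIV f"
    and smooth: "\<And>Y. GDERIV f Y :> G Y"
    and lam: "lam > 0"
    and stationary: "stationary_point G lam U B V"
    and X: "X = U ** B ** transpose V"
    and S: "S = G X"
    and dominant: "dominant_singular_vectors S \<sigma>\<^sub>1 u v"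
  shows "(\<not> is_arg_min (objective f lam) (\<lambda>_. True) X \<longrightarrow>
            \<sigma>\<^sub>1 > lam \<and>
            (\<exists>b0>0. \<forall>b. 0 < b \<and> b < b0 \<longrightarrow>
               objective f lam (X - b *\<^sub>R outer u v) < objective f lam X)) \<and>
         (\<forall>L>0. lipschitz_gradient L G \<longrightarrow>
            (\<forall>b\<ge>0. objective f lam X - objective f lam (X - b *\<^sub>R outer u v)
                      \<ge> guaranteed_decrease lam L X S u v b) \<and>
            (\<forall>b\<ge>0. guaranteed_decrease lam L X S u v b = b * (\<sigma>\<^sub>1 - lam - L / 2 * b)) \<and>
            (\<sigma>\<^sub>1 - lam) / L \<ge> 0 \<and>
            (\<forall>b\<ge>0. b \<noteq> (\<sigma>\<^sub>1 - lam) / L \<longrightarrow>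
               guaranteed_decrease lam L X S u v b
                 < guaranteed_decrease lam L X S u v ((\<sigma>\<^sub>1 - lam) / L)))"
proof -
  have feas: "U \<in> stiefel" "B \<in> sym_posdef" "V \<in> stiefel"
    using stationary by (simp_all add: stationary_point_def)
  have SX: "S = G (U ** B ** transpose V)" using S X by simp
  note at_stationary = lam feas stationary_point_dual[OF stationary SX] dominant X
  note subgradient = dual_variable_subgradient[OF at_stationary]
  note step = trace_norm_rank_one_step[OF at_stationary]
  have uv: "norm u = 1" "norm v = 1" and Sv: "u \<bullet> (S *v v) = \<sigma>\<^sub>1"
    using dominant
    by (auto simp: dominant_singular_vectors_def singular_vectors_def norm_eq_1)
  (* - S / lam is then a subgradient of the trace norm at X, and cancels the gradient S of f *)
  have min: "is_arg_min (objective f lam) (\<lambda>_. True) X" if "\<sigma>\<^sub>1 = lam"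
  proof -
    have "objective f lam X \<le> objective f lam Y" for Y
    proof -
      have "(- 1 / lam) *\<^sub>R S \<bullet> Y \<le> trace_norm Y"
        using subgradient(1)[OF that] by (blast intro: inner_contraction_le_trace_norm)
      with lam have "- (S \<bullet> Y) \<le> lam * trace_norm Y" by (simp add: field_simps)
      moreover have "- (S \<bullet> X) = lam * trace_norm X"
        using subgradient(2)[OF that] lam by (simp add: field_simps)
      ultimately show ?thesis
        using convex_above_gradient_plane[OF convex smooth, of X Y]
        by (simp add: objective_def S[symmetric] inner_diff_left inner_diff_right inner_commute[of _ S])
    qed
    then show ?thesis by (simp add: is_arg_min_def not_less)
  qed
  have descent: "\<exists>b0>0. \<forall>b. 0 < b \<and> b < b0 \<longrightarrow>
      objective f lam (X - b *\<^sub>R outer u v) < objective f lam X" if gt: "\<sigma>\<^sub>1 > lam"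
  proof -
    (* the objective along the step, since the trace norm grows by exactly b *)
    have "((\<lambda>b. f (X + b *\<^sub>R - outer u v) + lam * b) has_real_derivative lam - \<sigma>\<^sub>1) (at 0)"
      using gderiv_along_line[OF smooth, of X "- outer u v" 0] Sv
      by (auto intro!: derivative_eq_intros simp: S[symmetric] inner_commute[of _ S] inner_matrix_outer)
    from DERIV_neg_dec_right[OF this] gt obtain d where "d > 0"
      and "\<And>b. 0 < b \<Longrightarrow> b < d \<Longrightarrow> f (X - b *\<^sub>R outer u v) + lam * b < f X" by auto
    then show ?thesis
      by (intro exI[of _ d]) (auto simp: objective_def step distrib_left)
  qed
  have gd: "guaranteed_decrease lam L X S u v b = b * (\<sigma>\<^sub>1 - lam - L / 2 * b)"
    "guaranteed_decrease lam L X S u v b \<le> objective f lam X - objective f lam (X - b *\<^sub>R outer u v)"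
    if "L > 0" "lipschitz_gradient L G" "b \<ge> 0" for L b
  proof -
    have "f \<in> compatible_functions L X S"
      using convex smooth that S by (auto simp: compatible_functions_def)
    then show "guaranteed_decrease lam L X S u v b = b * (\<sigma>\<^sub>1 - lam - L / 2 * b)"
      "guaranteed_decrease lam L X S u v b \<le> objective f lam X - objective f lam (X - b *\<^sub>R outer u v)"
      using guaranteed_decrease_eq[OF that(1) uv Sv step[OF that(3)]] by blast+
  qed
  have opt: "b * (\<sigma>\<^sub>1 - lam - L / 2 * b) < (\<sigma>\<^sub>1 - lam) / L * (\<sigma>\<^sub>1 - lam - L / 2 * ((\<sigma>\<^sub>1 - lam) / L))"
    if "L > 0" "b \<noteq> (\<sigma>\<^sub>1 - lam) / L" for L b :: real
  proof -
    have "(\<sigma>\<^sub>1 - lam) / L * (\<sigma>\<^sub>1 - lam - L / 2 * ((\<sigma>\<^sub>1 - lam) / L)) - b * (\<sigma>\<^sub>1 - lam - L / 2 * b)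
        = L / 2 * ((\<sigma>\<^sub>1 - lam) / L - b)\<^sup>2"
      using that(1) by (simp add: field_simps power2_eq_square)
    also have "\<dots> > 0" using that by simp
    finally show ?thesis by simp
  qed
  have le: "lam \<le> \<sigma>\<^sub>1" by (rule regularization_le_dominant[OF at_stationary])
  show ?thesis
  proof (intro conjI impI allI)
    assume "\<not> is_arg_min (objective f lam) (\<lambda>_. True) X"
    then show gt: "\<sigma>\<^sub>1 > lam" using min le by (cases "\<sigma>\<^sub>1 = lam") auto
    show "\<exists>b0>0. \<forall>b. 0 < b \<and> b < b0 \<longrightarrow>
        objective f lam (X - b *\<^sub>R outer u v) < objective f lam X"
      by (rule descent[OF gt])
  next
    fix L b :: real
    assume L: "L > 0" "lipschitz_gradient L G"
    show step_nonneg: "(\<sigma>\<^sub>1 - lam) / L \<ge> 0" using le L by simp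
    assume b: "b \<ge> 0"
    show "guaranteed_decrease lam L X S u v b \<le> objective f lam X - objective f lam (X - b *\<^sub>R outer u v)"
      by (rule gd(2)[OF L b])
    show "guaranteed_decrease lam L X S u v b = b * (\<sigma>\<^sub>1 - lam - L / 2 * b)"
      by (rule gd(1)[OF L b])
    assume "b \<noteq> (\<sigma>\<^sub>1 - lam) / L"
    then show "guaranteed_decrease lam L X S u v b
        < guaranteed_decrease lam L X S u v ((\<sigma>\<^sub>1 - lam) / L)"
      unfolding gd(1)[OF L b] gd(1)[OF L step_nonneg] by (rule opt[OF L(1)])
  qed
qed

end
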